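(* Let $\psi:T\to\mathbb{C}$ be such that $M_\psi$ is a bounded operator from $L^\infty$ to $\mathcal{L}_{\mathbf{w}}$. Then the following statements are equivalent: (a) $M_\psi:L^\infty\to\mathcal{L}_{\mathbf{w}}$ is compact. (b) $\displaystyle\lim_{|v|\to\infty}|v||\psi(v)|=0$.
   Context: $T$ is the vertex set of a tree (a locally finite, connected, simply connected graph), rooted at a vertex $o$ and without terminal vertices (a terminal vertex is one having a unique neighbor), hence infinite. $|v|$ is the number of edges in the path from $o$ to $v$; $T^*=T\setminus\{o\}$; for $v\in T^*$, $v^-$ is the neighbor of $v$ closest to $o$. For $f:T\to\mathbb{C}$ and $v\in T^*$, $Df(v)=|f(v)-f(v^-)|$. The weighted Lipschitz space $\mathcal{L}_{\mathbf{w}}$ is the Banach space of all $f:T\to\mathbb{C}$ with $\sup_{v\in T^*}|v|Df(v)<\infty$, with norm $\|f\|_{\mathbf{w}}=|f(o)|+\sup_{v\in T^*}|v|Df(v)$. $L^\infty$ is the Banach space of bounded functions $f:T\to\mathbb{C}$ with $\|f\|_\infty=\sup_{v\in T}|f(v)|$. For $\psi:T\to\mathbb{C}$, $M_\psi f=\psi f$ (pointwise product). "$M_\psi:X\to Y$ is bounded" means that $\psi f\in Y$ for all $f\in X$ and $M_\psi$ is a bounded linear operator. *)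

theory Defs
  imports "HOL-Analysis.Analysis"
begin

section \<open>Trees\<close>

text \<open>A graph is given by its adjacency relation \<open>E\<close>; its vertex set is the whole type \<open>'a\<close>.\<close>

definition path_between :: "('a \<Rightarrow> 'a \<Rightarrow> bool) \<Rightarrow> 'a \<Rightarrow> 'a \<Rightarrow> 'a list \<Rightarrow> bool" where
  "path_between E u v p \<longleftrightarrow>
     p \<noteq> [] \<and> hd p = u \<and> last p = v \<and> distinct p \<and> successively E p"

definition graph_cycle :: "('a \<Rightarrow> 'a \<Rightarrow> bool) \<Rightarrow> 'a list \<Rightarrow> bool" where
  "graph_cycle E p \<longleftrightarrow>
     length p \<ge> 3 \<and> distinct p \<and> successively E p \<and> E (last p) (hd p)"

text \<open>Infinity of the vertex set is required explicitly: the one-vertex graph has no terminal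
  vertex either, and has to be excluded.\<close>

locale tree_without_terminal_vertices =
  fixes E :: "'a \<Rightarrow> 'a \<Rightarrow> bool"
  assumes symmetric: "E u v \<Longrightarrow> E v u"
    and loop_free: "\<not> E v v"
    and locally_finite: "finite {w. E v w}"
    and connected: "\<exists>p. path_between E u v p"
    and simply_connected: "\<not> graph_cycle E p"
    and no_terminal_vertex: "\<not> (\<exists>!w. E v w)"
    and infinite_vertices: "infinite (UNIV :: 'a set)"

definition depth :: "('a \<Rightarrow> 'a \<Rightarrow> bool) \<Rightarrow> 'a \<Rightarrow> 'a \<Rightarrow> nat" where
  "depth E r v = (THE n. \<exists>p. path_between E r v p \<and> n = length p - 1)"

definition parent :: "('a \<Rightarrow> 'a \<Rightarrow> bool) \<Rightarrow> 'a \<Rightarrow> 'a \<Rightarrow> 'a" where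
  "parent E r v = arg_min (depth E r) (E v)"

section \<open>Function spaces\<close>

text \<open>A normed space of functions is given by its carrier and its norm. The norms below are only
  meaningful on the respective carriers, since the supremum of an unbounded set of reals is
  unspecified.\<close>

definition Df :: "('a \<Rightarrow> 'a \<Rightarrow> bool) \<Rightarrow> 'a \<Rightarrow> ('a \<Rightarrow> complex) \<Rightarrow> 'a \<Rightarrow> real" where
  "Df E r f v = cmod (f v - f (parent E r v))"

definition Lw :: "('a \<Rightarrow> 'a \<Rightarrow> bool) \<Rightarrow> 'a \<Rightarrow> ('a \<Rightarrow> complex) set" where
  "Lw E r = {f. bdd_above ((\<lambda>v. real (depth E r v) * Df E r f v) ` (UNIV - {r}))}"

definition norm_Lw :: "('a \<Rightarrow> 'a \<Rightarrow> bool) \<Rightarrow> 'a \<Rightarrow> ('a \<Rightarrow> complex) \<Rightarrow> real" where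
  "norm_Lw E r f = cmod (f r) + (SUP v\<in>UNIV - {r}. real (depth E r v) * Df E r f v)"

definition Linf :: "('a \<Rightarrow> complex) set" where
  "Linf = {f. bounded (range f)}"

definition norm_Linf :: "('a \<Rightarrow> complex) \<Rightarrow> real" where
  "norm_Linf f = (SUP v. cmod (f v))"

text \<open>The value 0 off the carrier is a dummy; the library's metric spaces require the distance
  function to be symmetric and nonnegative on the whole type.\<close>

definition norm_dist ::
    "('a \<Rightarrow> complex) set \<Rightarrow> (('a \<Rightarrow> complex) \<Rightarrow> real) \<Rightarrow> ('a \<Rightarrow> complex) \<Rightarrow> ('a \<Rightarrow> complex) \<Rightarrow> real" where
  "norm_dist X N f g = (if f \<in> X \<and> g \<in> X then N (\<lambda>v. f v - g v) else 0)"

definition norm_topology ::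
    "('a \<Rightarrow> complex) set \<Rightarrow> (('a \<Rightarrow> complex) \<Rightarrow> real) \<Rightarrow> ('a \<Rightarrow> complex) topology" where
  "norm_topology X N = Metric_space.mtopology X (norm_dist X N)"

section \<open>Operators\<close>

definition bounded_operator ::
    "('a \<Rightarrow> complex) set \<Rightarrow> (('a \<Rightarrow> complex) \<Rightarrow> real) \<Rightarrow>
     ('a \<Rightarrow> complex) set \<Rightarrow> (('a \<Rightarrow> complex) \<Rightarrow> real) \<Rightarrow>
     (('a \<Rightarrow> complex) \<Rightarrow> ('a \<Rightarrow> complex)) \<Rightarrow> bool" where
  "bounded_operator X NX Y NY A \<longleftrightarrow>
     (\<forall>f\<in>X. A f \<in> Y) \<and>
     (\<forall>f\<in>X. \<forall>g\<in>X. A (\<lambda>v. f v + g v) = (\<lambda>v. A f v + A g v)) \<and>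
     (\<forall>c. \<forall>f\<in>X. A (\<lambda>v. c * f v) = (\<lambda>v. c * A f v)) \<and>
     (\<exists>C. \<forall>f\<in>X. NY (A f) \<le> C * NX f)"

definition compact_operator ::
    "('a \<Rightarrow> complex) set \<Rightarrow> (('a \<Rightarrow> complex) \<Rightarrow> real) \<Rightarrow>
     ('a \<Rightarrow> complex) set \<Rightarrow> (('a \<Rightarrow> complex) \<Rightarrow> real) \<Rightarrow>
     (('a \<Rightarrow> complex) \<Rightarrow> ('a \<Rightarrow> complex)) \<Rightarrow> bool" where
  "compact_operator X NX Y NY A \<longleftrightarrow>
     bounded_operator X NX Y NY A \<and>
     (\<forall>B. B \<subseteq> X \<and> (\<exists>C. \<forall>f\<in>B. NX f \<le> C) \<longrightarrow>
        compactin (norm_topology Y NY) (norm_topology Y NY closure_of (A ` B)))"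

definition mult_op :: "('a \<Rightarrow> complex) \<Rightarrow> ('a \<Rightarrow> complex) \<Rightarrow> ('a \<Rightarrow> complex)" where
  "mult_op \<psi> f = (\<lambda>v. \<psi> v * f v)"

end

theory Submission
  imports Defs
begin

text \<open>If (b) holds, then on the set \<open>K\<close> of functions bounded by \<open>C\<close>, which is compact in the topology of
  pointwise convergence by Tychonoff's theorem, \<open>M\<^sub>\<psi>\<close> is continuous into the weighted Lipschitz space.
  So the image of \<open>K\<close> is compact, hence closed, and contains the closure of the image of any set of
  functions bounded by \<open>C\<close>. Conversely, the images of the indicators of the vertices with
  \<open>|v| |\<psi>(v)| \<ge> \<epsilon>\<close> are at mutual distance at least \<open>\<epsilon>\<close>; inside a compact set there are only
  finitely many of them, so their depths are bounded.\<close>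

context tree_without_terminal_vertices
begin

section \<open>Paths, depth and levels of the tree\<close>

text \<open>Follow \<open>p\<close> up to its first vertex \<open>x\<close> on \<open>q\<close>,
  then return to \<open>u\<close> along \<open>q\<close> backwards. By the choice of
  \<open>x\<close> the two pieces share no vertex, so they close up to a cycle.\<close>

lemma paths_meet_imp_cycle:
  assumes p: "distinct (u # p)" "successively E (u # p)"
    and q: "distinct (u # q)" "successively E (u # q)"
    and "p \<noteq> []" "q \<noteq> []" "last p = last q" "hd p \<noteq> hd q"
  shows "\<exists>c. graph_cycle E c"
proof -
  have "\<exists>x\<in>set p. x \<in> set q"
    using assms(5-7) by (metis last_in_set)
  then obtain p1 x p2 where p_split: "p = p1 @ x # p2" "x \<in> set q" "\<forall>y\<in>set p1. y \<notin> set q"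
    using split_list_first_prop[of p "\<lambda>x. x \<in> set q"] by blast
  then obtain q1 q2 where q_split: "q = q1 @ x # q2"
    by (meson split_list)
  \<comment> \<open>If both were empty, \<open>x\<close> would be the head of \<open>p\<close> and
    of \<open>q\<close>. The extra vertex besides \<open>u\<close> and \<open>x\<close> gives the
    length 3 that a cycle needs.\<close>
  have "p1 \<noteq> [] \<or> q1 \<noteq> []"
    using p_split q_split \<open>hd p \<noteq> hd q\<close> by auto
  moreover have "successively E (u # q1 @ [x])"
    using q(2) unfolding q_split by (auto simp: successively_Cons successively_append_iff hd_append)
  then have "successively (\<lambda>y z. E z y) (u # q1 @ [x])"
    by (rule successively_mono) (rule symmetric)
  then have "successively E (rev (u # q1 @ [x]))"
    by (simp only: successively_rev)
  then have "successively E ((x # rev q1) @ [u])" by simp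
  then have "successively E (x # rev q1)" "E (last (x # rev q1)) u"
    unfolding successively_append_iff by auto
  moreover have "successively E (u # p1)" "E (last (u # p1)) x"
    using p(2) unfolding p_split append_Cons[symmetric] successively_append_iff by auto
  moreover have "distinct (u # p1 @ x # rev q1)"
    using p(1) q(1) p_split(3) unfolding p_split(1) q_split by auto
  ultimately have "graph_cycle E ((u # p1) @ (x # rev q1))"
    unfolding graph_cycle_def successively_append_iff by (auto simp: Suc_le_eq)
  then show ?thesis ..
qed

text \<open>Strip the common first vertex: tails with different heads but the same end would close a
  cycle. Uniqueness is what makes the \<open>THE\<close> in \<open>depth\<close> well
  defined.\<close>

lemma path_unique:
  assumes "path_between E u v p" "path_between E u v q"
  shows "p = q"
  using assms
proof (induction p arbitrary: u q)
  case Nil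
  then show ?case by (simp add: path_between_def)
next
  case (Cons a p)
  then obtain q' where q: "q = u # q'" and [simp]: "a = u"
    by (cases q) (auto simp: path_between_def)
  show ?case
  proof (cases "p = [] \<or> q' = []")
    case True
    then show ?thesis
      using Cons.prems q by (auto simp: path_between_def split: if_splits)
  next
    case False
    have "hd p = hd q'"
      using paths_meet_imp_cycle[of u p q'] Cons.prems q False simply_connected
      by (auto simp: path_between_def)
    moreover have "path_between E (hd p) v p" "path_between E (hd q') v q'"
      using Cons.prems q False by (auto simp: path_between_def successively_Cons)
    ultimately show ?thesis
      using Cons.IH q by simp
  qed
qed

lemma depth_eq:
  assumes "path_between E r v p"
  shows "depth E r v = length p - 1"
  unfolding depth_def using assms path_unique by blast

lemma depth_root: "depth E r r = 0"
  using depth_eq[of r r "[r]"] by (simp add: path_between_def)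

text \<open>The path from \<open>r\<close> to \<open>w\<close> either avoids \<open>v\<close> and
  extends by the edge to \<open>v\<close>, or passes through \<open>v\<close> strictly before its
  end, and then its initial segment is the path to \<open>v\<close>. Hence no neighbour of
  \<open>v\<close> lies more than one level above it.\<close>

lemma depth_neighbour:
  assumes "E v w"
  shows "depth E r v = Suc (depth E r w) \<or> depth E r v < depth E r w"
proof -
  obtain p where p: "path_between E r w p"
    using connected by blast
  show ?thesis
  proof (cases "v \<in> set p")
    case False
    then have "path_between E r v (p @ [v])"
      using p symmetric[OF assms] by (auto simp: path_between_def successively_append_iff)
    from depth_eq[OF this] depth_eq[OF p] p show ?thesis
      by (cases p) (auto simp: path_between_def)
  next
    case True
    then obtain p1 p2 where split: "p = p1 @ v # p2"
      by (meson split_list)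
    then have "path_between E r v (p1 @ [v])"
      using p by (auto simp: path_between_def successively_append_iff hd_append)
    moreover have "p2 \<noteq> []"
      using split p assms loop_free by (auto simp: path_between_def)
    ultimately show ?thesis
      using depth_eq[OF p] split by (auto dest: depth_eq)
  qed
qed

lemma ex_shallower_neighbour:
  assumes "v \<noteq> r"
  shows "\<exists>w. E v w \<and> depth E r v = Suc (depth E r w)"
proof -
  obtain p where p: "path_between E r v p"
    using connected by blast
  then have "p = butlast p @ [v]"
    by (metis append_butlast_last_id path_between_def)
  then obtain p' where p': "p = p' @ [v]" by blast
  with p assms have ne: "p' \<noteq> []"
    by (auto simp: path_between_def)
  with p p' have "path_between E r (last p') p'" "E (last p') v"
    by (auto simp: path_between_def successively_append_iff)
  with depth_eq[OF p] p' ne show ?thesis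
    by (intro exI[of _ "last p'"]) (auto simp: symmetric dest: depth_eq)
qed

text \<open>The penultimate vertex of the path from \<open>r\<close> to \<open>v\<close> is a
  neighbour one level up, and \<open>depth_neighbour\<close> excludes anything shallower, so the
  minimum in \<open>parent\<close> is attained exactly there.\<close>

lemma parent:
  assumes "v \<noteq> r"
  shows "E v (parent E r v)" and "depth E r v = Suc (depth E r (parent E r v))"
proof -
  obtain w where w: "E v w" "depth E r v = Suc (depth E r w)"
    using ex_shallower_neighbour[OF assms] by blast
  show "E v (parent E r v)"
    unfolding parent_def using w(1) by (rule arg_min_natI)
  moreover have "depth E r (parent E r v) \<le> depth E r w"
    unfolding parent_def using w(1) by (rule arg_min_nat_le)
  ultimately show "depth E r v = Suc (depth E r (parent E r v))"
    using depth_neighbour[of v "parent E r v" r] w(2) by auto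
qed

lemma depth_eq_0_iff: "depth E r v = 0 \<longleftrightarrow> v = r"
  using parent(2)[of v r] depth_root by (cases "v = r") auto

lemma finite_level: "finite {v. depth E r v = n}"
proof (induction n)
  case 0
  then show ?case by (simp add: depth_eq_0_iff)
next
  case (Suc n)
  \<comment> \<open>Each vertex of the next level is a neighbour of its parent; local finiteness
    then carries finiteness down.\<close>
  have "{v. depth E r v = Suc n} \<subseteq> (\<Union>u\<in>{u. depth E r u = n}. {w. E u w})"
  proof
    fix v
    assume "v \<in> {v. depth E r v = Suc n}"
    then have v: "depth E r v = Suc n" by simp
    then have "v \<noteq> r"
      by (metis depth_root nat.distinct(1))
    from parent[OF this] v have "depth E r (parent E r v) = n" "E (parent E r v) v"
      by (simp, metis symmetric)
    then show "v \<in> (\<Union>u\<in>{u. depth E r u = n}. {w. E u w})"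
      by blast
  qed
  then show ?case
    by (rule finite_subset) (use Suc locally_finite in auto)
qed

lemma finite_depth_less: "finite {v. depth E r v < n}"
proof -
  have "{v. depth E r v < n} = (\<Union>k<n. {v. depth E r v = k})" by auto
  then show ?thesis using finite_level by simp
qed

text \<open>Descends from the root along parents; this gives the definiteness of
  \<open>norm_Lw\<close>.\<close>

lemma eq_0_if_Df_eq_0:
  assumes "f r = 0" and "\<And>v. v \<noteq> r \<Longrightarrow> Df E r f v = 0"
  shows "f v = 0"
proof (induction "depth E r v" arbitrary: v rule: less_induct)
  case less
  show ?case
  proof (cases "v = r")
    case False
    then have "f (parent E r v) = 0"
      using less[of "parent E r v"] parent(2)[of v r] by simp
    with assms(2)[OF False] show ?thesis by (simp add: Df_def)
  qed (simp add: assms)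
qed

section \<open>The weighted Lipschitz space as a metric space\<close>

text \<open>Keeps the supremum in \<open>norm_Lw\<close> from running over the empty set, where it
  would be unspecified.\<close>

lemma nonroot_nonempty: "UNIV - {r :: 'a} \<noteq> {}"
  using infinite_remove[OF infinite_vertices, of r] by (metis finite.emptyI)

lemma norm_Lw_ge:
  assumes "f \<in> Lw E r" "v \<noteq> r"
  shows "cmod (f r) + real (depth E r v) * Df E r f v \<le> norm_Lw E r f"
  using assms unfolding Lw_def norm_Lw_def
  by (auto intro!: cSUP_upper)

lemma norm_Lw_le:
  assumes "\<And>v. v \<noteq> r \<Longrightarrow> cmod (f r) + real (depth E r v) * Df E r f v \<le> c"
  shows "norm_Lw E r f \<le> c"
proof -
  have "(SUP v\<in>UNIV - {r}. real (depth E r v) * Df E r f v) \<le> c - cmod (f r)"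
    by (intro cSUP_least nonroot_nonempty) (use assms in \<open>auto simp: algebra_simps\<close>)
  then show ?thesis by (simp add: norm_Lw_def)
qed

lemma weighted_Df_diff_le:
  "real (depth E r v) * Df E r (\<lambda>v. f v - g v) v
    \<le> real (depth E r v) * Df E r f v + real (depth E r v) * Df E r g v"
proof -
  have "Df E r (\<lambda>v. f v - g v) v \<le> Df E r f v + Df E r g v"
    unfolding Df_def
    using norm_triangle_ineq4[of "f v - f (parent E r v)" "g v - g (parent E r v)"]
    by (simp add: algebra_simps)
  then show ?thesis
    by (metis distrib_left mult_left_mono of_nat_0_le_iff)
qed

lemma Lw_diff:
  assumes "f \<in> Lw E r" "g \<in> Lw E r"
  shows "(\<lambda>v. f v - g v) \<in> Lw E r"
proof -
  obtain a where "\<And>v. v \<noteq> r \<Longrightarrow> real (depth E r v) * Df E r f v \<le> a"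
    using assms(1) by (auto simp: Lw_def bdd_above_def)
  moreover obtain b where "\<And>v. v \<noteq> r \<Longrightarrow> real (depth E r v) * Df E r g v \<le> b"
    using assms(2) by (auto simp: Lw_def bdd_above_def)
  ultimately have "real (depth E r v) * Df E r (\<lambda>v. f v - g v) v \<le> a + b" if "v \<noteq> r" for v
    using that by (intro order_trans[OF weighted_Df_diff_le] add_mono) auto
  then show ?thesis
    by (auto simp: Lw_def bdd_above_def)
qed

lemma norm_Lw_diff_le:
  assumes "f \<in> Lw E r" "g \<in> Lw E r"
  shows "norm_Lw E r (\<lambda>v. f v - g v) \<le> norm_Lw E r f + norm_Lw E r g"
proof (rule norm_Lw_le)
  fix v assume "v \<noteq> r"
  with assms have "cmod (f r) + real (depth E r v) * Df E r f v \<le> norm_Lw E r f"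
    "cmod (g r) + real (depth E r v) * Df E r g v \<le> norm_Lw E r g"
    by (auto intro: norm_Lw_ge)
  then show "cmod (f r - g r) + real (depth E r v) * Df E r (\<lambda>v. f v - g v) v
      \<le> norm_Lw E r f + norm_Lw E r g"
    using weighted_Df_diff_le[of r v f g] norm_triangle_ineq4[of "f r" "g r"] by linarith
qed

lemma norm_Lw_nonneg:
  assumes "f \<in> Lw E r"
  shows "0 \<le> norm_Lw E r f"
proof -
  obtain v where "v \<noteq> r" using nonroot_nonempty by blast
  from norm_Lw_ge[OF assms this] show ?thesis
    by (smt (verit) Df_def norm_ge_zero mult_nonneg_nonneg of_nat_0_le_iff)
qed

lemma norm_Lw_eq_0_iff:
  assumes "f \<in> Lw E r"
  shows "norm_Lw E r f = 0 \<longleftrightarrow> f = (\<lambda>_. 0)"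
proof
  assume "norm_Lw E r f = 0"
  then have *: "cmod (f r) + real (depth E r v) * Df E r f v \<le> 0" if "v \<noteq> r" for v
    using norm_Lw_ge[OF assms that] by simp
  have nonneg: "0 \<le> real (depth E r v) * Df E r f v" for v
    by (simp add: Df_def)
  obtain v where "v \<noteq> r" using nonroot_nonempty by blast
  from *[OF this] nonneg[of v] have "f r = 0"
    by (smt (verit) norm_ge_zero norm_eq_zero)
  moreover have "Df E r f v = 0" if "v \<noteq> r" for v
  proof -
    have "real (depth E r v) * Df E r f v = 0"
      using *[OF that] nonneg[of v] by (smt (verit) norm_ge_zero)
    with that show ?thesis by (simp add: depth_eq_0_iff)
  qed
  ultimately show "f = (\<lambda>_. 0)"
    using eq_0_if_Df_eq_0 by blast
next
  assume "f = (\<lambda>_. 0)"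
  then show "norm_Lw E r f = 0"
    using nonroot_nonempty by (simp add: norm_Lw_def Df_def)
qed

lemma norm_Lw_minus_commute: "norm_Lw E r (\<lambda>v. f v - g v) = norm_Lw E r (\<lambda>v. g v - f v)"
proof -
  have "Df E r (\<lambda>v. f v - g v) v = Df E r (\<lambda>v. g v - f v) v" for v
    unfolding Df_def
    by (subst norm_minus_cancel[symmetric]) (simp add: algebra_simps)
  then show ?thesis
    by (simp add: norm_Lw_def norm_minus_commute)
qed

lemma Metric_space_Lw: "Metric_space (Lw E r) (norm_dist (Lw E r) (norm_Lw E r))"
proof
  fix f g h :: "'a \<Rightarrow> complex"
  show "0 \<le> norm_dist (Lw E r) (norm_Lw E r) f g"
    by (simp add: norm_dist_def norm_Lw_nonneg Lw_diff)
  show "norm_dist (Lw E r) (norm_Lw E r) f g = norm_dist (Lw E r) (norm_Lw E r) g f"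
    using norm_Lw_minus_commute by (auto simp: norm_dist_def)
  assume f: "f \<in> Lw E r" and g: "g \<in> Lw E r"
  show "norm_dist (Lw E r) (norm_Lw E r) f g = 0 \<longleftrightarrow> f = g"
    using f g by (auto simp: norm_dist_def norm_Lw_eq_0_iff Lw_diff fun_eq_iff)
  assume h: "h \<in> Lw E r"
  show "norm_dist (Lw E r) (norm_Lw E r) f h
      \<le> norm_dist (Lw E r) (norm_Lw E r) f g + norm_dist (Lw E r) (norm_Lw E r) g h"
    using norm_Lw_diff_le[OF Lw_diff[OF f g] Lw_diff[OF h g]] f g h norm_Lw_minus_commute[of r g h]
    by (simp add: norm_dist_def)
qed

section \<open>Norm estimates for indicators and products\<close>

text \<open>The parent of \<open>v\<close> is shallower than both \<open>v\<close> and
  \<open>w\<close>, so the function vanishes there and jumps by \<open>a\<close> at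
  \<open>v\<close>. Without the depth condition \<open>w\<close> could be that parent, the jump
  would be \<open>a + b\<close>, and it might cancel.\<close>

lemma norm_Lw_indicator_diff_ge:
  fixes a b :: complex
  assumes "v \<noteq> r" "v \<noteq> w" "depth E r v \<le> depth E r w"
    and "(\<lambda>x. (if x = v then a else 0) - (if x = w then b else 0)) \<in> Lw E r"
  shows "real (depth E r v) * cmod a
    \<le> norm_Lw E r (\<lambda>x. (if x = v then a else 0) - (if x = w then b else 0))"
proof -
  have "parent E r v \<noteq> w" "parent E r v \<noteq> v"
    using parent(2)[OF assms(1)] assms(3) by auto
  then have "Df E r (\<lambda>x. (if x = v then a else 0) - (if x = w then b else 0)) v = cmod a"
    using assms(2) by (simp add: Df_def)
  with norm_Lw_ge[OF assms(4,1)] show ?thesis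
    by (smt (verit) norm_ge_zero)
qed

text \<open>One \<open>c\<close> pays for the value at the root, one for \<open>v\<close> and one
  for its parent. The shifted weight \<open>Suc (depth E r v)\<close> is nonzero at the root, and at
  the parent it equals the depth of \<open>v\<close>.\<close>

lemma norm_Lw_mult_le:
  assumes "\<And>v. real (Suc (depth E r v)) * cmod (\<psi> v * h v) \<le> c"
  shows "norm_Lw E r (\<lambda>v. \<psi> v * h v) \<le> 3 * c"
proof (rule norm_Lw_le)
  fix v assume v: "v \<noteq> r"
  let ?u = "parent E r v"
  have "real (depth E r v) * Df E r (\<lambda>v. \<psi> v * h v) v
      \<le> real (depth E r v) * (cmod (\<psi> v * h v) + cmod (\<psi> ?u * h ?u))"
    unfolding Df_def by (intro mult_left_mono norm_triangle_ineq4) auto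
  also have "\<dots> \<le> real (Suc (depth E r v)) * cmod (\<psi> v * h v)
      + real (Suc (depth E r ?u)) * cmod (\<psi> ?u * h ?u)"
    using parent(2)[OF v] by (simp add: algebra_simps)
  also have "\<dots> \<le> c + c"
    by (intro add_mono assms)
  finally show "cmod (\<psi> r * h r) + real (depth E r v) * Df E r (\<lambda>v. \<psi> v * h v) v \<le> 3 * c"
    using assms[of r] by (simp add: depth_root)
qed

section \<open>Compactness forces decay\<close>

lemma compact_imp_tendsto:
  assumes "compact_operator Linf norm_Linf (Lw E r) (norm_Lw E r) (mult_op \<psi>)"
  shows "((\<lambda>v. real (depth E r v) * cmod (\<psi> v)) \<longlongrightarrow> 0) (filtercomap (depth E r) at_top)"
proof (rule tendstoI)
  fix e :: real
  assume e: "0 < e"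
  interpret Metric_space "Lw E r" "norm_dist (Lw E r) (norm_Lw E r)"
    by (rule Metric_space_Lw)
  define S where "S = {v. e \<le> real (depth E r v) * cmod (\<psi> v)}"
  define \<xi> :: "'a \<Rightarrow> 'a \<Rightarrow> complex" where "\<xi> v = (\<lambda>x. if x = v then 1 else 0)" for v
  have \<xi>: "\<xi> v \<in> Linf" "norm_Linf (\<xi> v) \<le> 1" for v
    by (auto simp: \<xi>_def Linf_def norm_Linf_def bounded_iff intro!: cSUP_least exI[of _ 1])
  have mult: "mult_op \<psi> (\<xi> v) = (\<lambda>x. if x = v then \<psi> v else 0)" for v
    by (auto simp: mult_op_def \<xi>_def)
  have in_Lw: "mult_op \<psi> (\<xi> v) \<in> Lw E r" for v
    using assms \<xi> by (auto simp: compact_operator_def bounded_operator_def)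
  have "range \<xi> \<subseteq> Linf" "\<forall>f\<in>range \<xi>. norm_Linf f \<le> 1"
    using \<xi> by auto
  then have "compactin mtopology (mtopology closure_of (mult_op \<psi> ` range \<xi>))"
    using assms unfolding compact_operator_def norm_topology_def by blast
  then have "mtotally_bounded (mtopology closure_of (mult_op \<psi> ` range \<xi>))"
    by (rule compactin_imp_mtotally_bounded)
  \<comment> \<open>Radius \<open>e/2\<close> is chosen so that two points in one ball are less than
    \<open>e\<close> apart; the map \<open>c\<close> to the centres is then injective on
    \<open>S\<close>.\<close>
  then obtain K where K: "finite K" "K \<subseteq> mtopology closure_of (mult_op \<psi> ` range \<xi>)"
      "mtopology closure_of (mult_op \<psi> ` range \<xi>) \<subseteq> (\<Union>x\<in>K. mball x (e/2))"
    using e unfolding mtotally_bounded_def by (metis half_gt_zero)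
  have "mult_op \<psi> ` range \<xi> \<subseteq> mtopology closure_of (mult_op \<psi> ` range \<xi>)"
    by (rule closure_of_subset) (use in_Lw in auto)
  with K(3) have "\<exists>x\<in>K. mult_op \<psi> (\<xi> v) \<in> mball x (e/2)" for v by blast
  then obtain c where c: "\<And>v. c v \<in> K" "\<And>v. mult_op \<psi> (\<xi> v) \<in> mball (c v) (e/2)"
    by metis
  have separated: "e \<le> norm_dist (Lw E r) (norm_Lw E r) (mult_op \<psi> (\<xi> v)) (mult_op \<psi> (\<xi> w))"
    if "v \<in> S" "v \<noteq> w" "depth E r v \<le> depth E r w" for v w
  proof -
    \<comment> \<open>At the root the weighted value is 0, which is below \<open>e\<close>.\<close>
    have "v \<noteq> r" using that e by (auto simp: S_def depth_root)
    from norm_Lw_indicator_diff_ge[OF this that(2,3), of "\<psi> v" "\<psi> w"] that(1) show ?thesis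
      using in_Lw[of v] in_Lw[of w] Lw_diff[OF in_Lw[of v] in_Lw[of w]]
      by (simp add: norm_dist_def mult S_def)
  qed
  have "inj_on c S"
  proof (rule inj_onI, rule ccontr)
    fix v w assume vw: "v \<in> S" "w \<in> S" "c v = c w" "v \<noteq> w"
    let ?d = "norm_dist (Lw E r) (norm_Lw E r)"
    have "?d (mult_op \<psi> (\<xi> v)) (mult_op \<psi> (\<xi> w))
        \<le> ?d (mult_op \<psi> (\<xi> v)) (c v) + ?d (c v) (mult_op \<psi> (\<xi> w))"
      using c(2)[of v] in_Lw by (intro triangle) auto
    also have "\<dots> < e/2 + e/2"
      using c(2)[of v] c(2)[of w] vw(3) by (intro add_strict_mono) (auto simp: commute)
    finally show False
      using separated[of v w] separated[of w v] vw commute[of "mult_op \<psi> (\<xi> v)"]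
      by (cases "depth E r v \<le> depth E r w") auto
  qed
  moreover have "finite (c ` S)"
    using K(1) c(1) by (meson finite_subset image_subsetI)
  ultimately have "finite S"
    by (rule finite_imageD[rotated])
  then obtain N where N: "\<And>v. v \<in> S \<Longrightarrow> depth E r v < N"
    using finite_nat_set_iff_bounded[of "depth E r ` S"] by auto
  have "\<forall>v. N \<le> depth E r v \<longrightarrow> dist (real (depth E r v) * cmod (\<psi> v)) 0 < e"
    using N by (auto simp: S_def not_le[symmetric] dist_real_def abs_mult)
  then show "\<forall>\<^sub>F v in filtercomap (depth E r) at_top.
      dist (real (depth E r v) * cmod (\<psi> v)) 0 < e"
    by (auto simp: eventually_filtercomap_at_top_linorder)
qed

section \<open>Decay implies compactness\<close>

text \<open>The topology of the function type is the product topology, and the set is a product of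
  closed discs.\<close>

lemma compact_bounded_functions: "compact {g :: 'a \<Rightarrow> complex. \<forall>v. cmod (g v) \<le> C}"
proof -
  have "{g :: 'a \<Rightarrow> complex. \<forall>v. cmod (g v) \<le> C} = (\<Pi>\<^sub>E v\<in>UNIV. cball 0 C)"
    by (auto simp: PiE_def)
  then show ?thesis
    using compactin_PiE[of "\<lambda>_. euclidean" UNIV "\<lambda>_::'a. cball (0::complex) C"]
    by (simp add: euclidean_product_topology)
qed

text \<open>On a bounded set of functions, pointwise convergence is enough for norm convergence of the
  products with \<open>\<psi>\<close>: the decay of \<open>\<psi>\<close> controls all but finitely many vertices.\<close>

lemma continuous_map_mult_op:
  assumes lim: "((\<lambda>v. real (depth E r v) * cmod (\<psi> v)) \<longlongrightarrow> 0) (filtercomap (depth E r) at_top)"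
    and into: "\<And>g. g \<in> Linf \<Longrightarrow> mult_op \<psi> g \<in> Lw E r"
  shows "continuous_map (top_of_set {g. \<forall>v. cmod (g v) \<le> C})
    (norm_topology (Lw E r) (norm_Lw E r)) (mult_op \<psi>)"
proof -
  interpret Metric_space "Lw E r" "norm_dist (Lw E r) (norm_Lw E r)"
    by (rule Metric_space_Lw)
  let ?K = "{g :: 'a \<Rightarrow> complex. \<forall>v. cmod (g v) \<le> C}"
  have K_Lw: "mult_op \<psi> g \<in> Lw E r" if "g \<in> ?K" for g
    using that by (intro into) (auto simp: Linf_def bounded_iff)
  have "\<exists>U. openin (top_of_set ?K) U \<and> g \<in> U \<and> (\<forall>h\<in>U. mult_op \<psi> h \<in> mball (mult_op \<psi> g) e)"
    if g: "g \<in> ?K" and e: "0 < e" for g e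
  proof -
    define \<phi> where "\<phi> v = real (Suc (depth E r v)) * cmod (\<psi> v)" for v
    have C: "0 \<le> C"
      using g by (smt (verit) mem_Collect_eq norm_ge_zero)
    \<comment> \<open>Far from the root the product is at most \<open>2 * \<delta>\<close> times
      \<open>2 * C\<close>, which is to stay below \<open>e / 4\<close>; \<open>C + 1\<close> avoids
      division by zero.\<close>
    define \<delta> where "\<delta> = e / (16 * (C + 1))"
    have \<delta>: "0 < \<delta>" "4 * \<delta> * C \<le> e / 4"
      using e C by (auto simp: \<delta>_def field_simps)
    from tendstoD[OF lim \<delta>(1)] obtain N
      where N: "\<And>v. N \<le> depth E r v \<Longrightarrow> real (depth E r v) * cmod (\<psi> v) < \<delta>"
      by (auto simp: eventually_filtercomap_at_top_linorder dist_real_def abs_mult)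
    \<comment> \<open>With \<open>Suc N\<close> instead of \<open>N\<close>, vertices outside
      \<open>F\<close> have depth at least 1, so \<open>Suc (depth E r v)\<close> is at most twice
      the depth.\<close>
    define F where "F = {v. depth E r v < Suc N}"
    define U where "U = (\<Inter>v\<in>F. {h. \<phi> v * cmod (h v - g v) < e / 4})"
    \<comment> \<open>\<open>F\<close> is finite, so \<open>U\<close> constrains only finitely many
      coordinates.\<close>
    have "open U"
      unfolding U_def F_def
      by (intro open_INT finite_depth_less ballI open_Collect_less continuous_intros
          continuous_on_product_coordinates)
    moreover have "g \<in> U"
      using e by (simp add: U_def)
    moreover have "mult_op \<psi> h \<in> mball (mult_op \<psi> g) e" if h: "h \<in> ?K" "h \<in> U" for h
    proof -
      \<comment> \<open>The factor 3 of \<open>norm_Lw_mult_le\<close> turns \<open>e / 4\<close>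
        into a bound strictly below \<open>e\<close>.\<close>
      have "real (Suc (depth E r v)) * cmod (\<psi> v * (g v - h v)) \<le> e / 4" for v
      proof (cases "v \<in> F")
        case True
        with h(2) have "\<phi> v * cmod (h v - g v) < e / 4" by (auto simp: U_def)
        then show ?thesis
          by (simp add: \<phi>_def norm_mult norm_minus_commute mult.assoc)
      next
        case False
        then have "Suc N \<le> depth E r v" by (simp add: F_def)
        then have "\<phi> v \<le> 2 * (real (depth E r v) * cmod (\<psi> v))"
          unfolding \<phi>_def mult.assoc[symmetric] by (intro mult_right_mono) auto
        also have "\<dots> \<le> 2 * \<delta>"
          using N[of v] \<open>Suc N \<le> _\<close> by simp
        finally have "\<phi> v \<le> 2 * \<delta>" .
        moreover have "cmod (g v - h v) \<le> 2 * C"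
          using g h(1) norm_triangle_ineq4[of "g v" "h v"] by (smt (verit) mem_Collect_eq)
        ultimately have "\<phi> v * cmod (g v - h v) \<le> (2 * \<delta>) * (2 * C)"
          using \<delta> C by (intro mult_mono) auto
        with \<delta>(2) show ?thesis
          by (simp add: \<phi>_def norm_mult mult.assoc)
      qed
      from norm_Lw_mult_le[of r \<psi> "\<lambda>v. g v - h v", OF this] e
      have "norm_Lw E r (\<lambda>v. mult_op \<psi> g v - mult_op \<psi> h v) < e"
        by (simp add: mult_op_def algebra_simps)
      then show ?thesis
        using K_Lw g h(1) by (simp add: norm_dist_def)
    qed
    ultimately show ?thesis
      using g by (intro exI[of _ "?K \<inter> U"]) (auto simp: openin_open_Int)
  qed
  then show ?thesis
    unfolding norm_topology_def continuous_map_to_metric by simp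
qed

lemma tendsto_imp_compact:
  assumes lim: "((\<lambda>v. real (depth E r v) * cmod (\<psi> v)) \<longlongrightarrow> 0) (filtercomap (depth E r) at_top)"
    and bdd: "bounded_operator Linf norm_Linf (Lw E r) (norm_Lw E r) (mult_op \<psi>)"
  shows "compact_operator Linf norm_Linf (Lw E r) (norm_Lw E r) (mult_op \<psi>)"
  unfolding compact_operator_def
proof (intro conjI bdd allI impI)
  interpret Metric_space "Lw E r" "norm_dist (Lw E r) (norm_Lw E r)"
    by (rule Metric_space_Lw)
  let ?T = "norm_topology (Lw E r) (norm_Lw E r)"
  fix B :: "('a \<Rightarrow> complex) set"
  assume "B \<subseteq> Linf \<and> (\<exists>C. \<forall>f\<in>B. norm_Linf f \<le> C)"
  then obtain C where B: "B \<subseteq> Linf" "\<And>f. f \<in> B \<Longrightarrow> norm_Linf f \<le> C" by blast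
  let ?K = "{g :: 'a \<Rightarrow> complex. \<forall>v. cmod (g v) \<le> C}"
  have "cmod (f v) \<le> C" if "f \<in> B" for f v
  proof -
    \<comment> \<open>Membership in \<open>Linf\<close> is needed for the supremum
      \<open>norm_Linf f\<close> to dominate the values of \<open>f\<close>.\<close>
    have "bdd_above (range (\<lambda>v. cmod (f v)))"
      using that B(1) by (auto simp: Linf_def bounded_iff bdd_above_def)
    then have "cmod (f v) \<le> norm_Linf f"
      unfolding norm_Linf_def by (intro cSUP_upper) auto
    with B(2)[OF that] show ?thesis by simp
  qed
  then have "B \<subseteq> ?K" by blast
  have "compactin ?T (mult_op \<psi> ` ?K)"
    using bdd
    by (intro image_compactin[OF _ continuous_map_mult_op[OF lim]])
      (auto simp: bounded_operator_def compactin_subtopology compact_bounded_functions)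
  moreover from this have "closedin ?T (mult_op \<psi> ` ?K)"
    unfolding norm_topology_def by (intro compactin_imp_closedin Hausdorff_space_mtopology)
  then have "?T closure_of (mult_op \<psi> ` B) \<subseteq> mult_op \<psi> ` ?K"
    using \<open>B \<subseteq> ?K\<close> by (intro closure_of_minimal image_mono)
  ultimately show "compactin ?T (?T closure_of (mult_op \<psi> ` B))"
    by (rule closed_compactin) simp
qed

end

theorem theorem5p6:
  fixes E :: "'a \<Rightarrow> 'a \<Rightarrow> bool" and r :: 'a and \<psi> :: "'a \<Rightarrow> complex"
  assumes "tree_without_terminal_vertices E"
    and "bounded_operator Linf norm_Linf (Lw E r) (norm_Lw E r) (mult_op \<psi>)"
  shows "compact_operator Linf norm_Linf (Lw E r) (norm_Lw E r) (mult_op \<psi>) \<longleftrightarrow>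
    ((\<lambda>v. real (depth E r v) * cmod (\<psi> v)) \<longlongrightarrow> 0) (filtercomap (depth E r) at_top)"
proof -
  interpret tree_without_terminal_vertices E
    by (rule assms(1))
  show ?thesis
    using compact_imp_tendsto tendsto_imp_compact[OF _ assms(2)] by blast
qed

end
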